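(* If $$\kappa_{jlm}(\theta):=\mathbb{E}_{p_\theta}\left[(u_j-\eta_j(\theta))(u_l-\eta_l(\theta))(u_m-\eta_m(\theta))\right]=0$$ for all $j,l,m\in\{1,\ldots,d\}$ and all $\theta\in\Theta$, then $ds^2_{\mathcal{M}}=ds^2_{\mathrm{Fisher}}$ on $\Theta$.
   Context: Let $(X,\mathcal{X},\mu)$ be a $\sigma$-finite measure space and let $\mathcal{M}_\mu$ be the set of measurable $p:X\to\mathbb{R}$ with $p>0$ $\mu$-a.e. and $\int_X p\,d\mu=1$. For $p\in\mathcal{M}_\mu$ write $\mathbb{E}_p[u]=\int_X u\,p\,d\mu$ (entrywise for matrices). Fix a reference density $p\in\mathcal{M}_\mu$. Let $B_p$ be the Banach space of ($\mu$-a.e. classes of) measurable $u:X\to\mathbb{R}$ such that $\mathbb{E}_p[\cosh(\alpha u)-1]<\infty$ for some $\alpha>0$ and $\mathbb{E}_p[u]=0$, with norm $\|u\|_p=\inf\{r>0:\mathbb{E}_p[\cosh(u/r)-1]\le 1\}$. For $u\in B_p$ let $K_p(u)=\log\mathbb{E}_p[e^u]\in[0,+\infty]$, $\mathrm{Dom}(K_p)=\{u\in B_p:K_p(u)<\infty\}$, with interior $\mathrm{Dom}(K_p)^\circ$ in $B_p$. Fix $d\ge 1$ and $u_1,\ldots,u_d\in B_p$ linearly independent in $L^2(p\cdot\mu)$ (standing assumption). Let $\Theta=\{\theta\in\mathbb{R}^d:\sum_j\theta_ju_j\in\mathrm{Dom}(K_p)^\circ\}$ (open), $\psi(\theta)=K_p(\sum_j\theta_ju_j)$,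 $p_\theta=e^{\sum_j\theta_ju_j-\psi(\theta)}p$. Put $\eta_j(\theta)=\mathbb{E}_{p_\theta}[u_j]$ and $[I(\theta)]_{jk}=\mathrm{Cov}_{p_\theta}(u_j,u_k)$ (Fisher information matrix, symmetric positive definite). $V(x)=(u_1(x),\ldots,u_d(x),1)^\top$ and $S(\theta)=\mathbb{E}_{p_\theta}[VV^\top]$, a symmetric positive definite $(d+1)\times(d+1)$ matrix. The line element of the pullback of the affine-invariant Riemannian metric $\langle\Xi,\Omega\rangle_S=\frac12\mathrm{tr}(S^{-1}\Xi S^{-1}\Omega)$ via $\theta\mapsto S(\theta)$ is $ds^2_{\mathcal{M}}=\sum_{j,k}\frac12\mathrm{tr}\left(S^{-1}\frac{\partial S}{\partial\theta_j}S^{-1}\frac{\partial S}{\partial\theta_k}\right)d\theta_jd\theta_k$, and the Fisher–Rao line element is $ds^2_{\mathrm{Fisher}}=\sum_{j,k}I_{jk}(\theta)\,d\theta_jd\theta_k$. *)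

theory Defs
  imports "HOL-Analysis.Analysis"
begin

definition densities :: "'a measure \<Rightarrow> ('a \<Rightarrow> real) set" where
  "densities M = {p \<in> borel_measurable M. (AE x in M. p x > 0) \<and> (LINT x|M. p x) = 1}"

definition expect :: "'a measure \<Rightarrow> ('a \<Rightarrow> real) \<Rightarrow> ('a \<Rightarrow> real) \<Rightarrow> real" where
  "expect M p f = (LINT x|M. f x * p x)"

definition expect_mat ::
  "'a measure \<Rightarrow> ('a \<Rightarrow> real) \<Rightarrow> ('a \<Rightarrow> real^'n^'m) \<Rightarrow> real^'n^'m" where
  "expect_mat M p A = (\<chi> i k. expect M p (\<lambda>x. A x $ i $ k))"

text \<open>The expectation of a nonnegative function, with values in \<open>[0, \<infinity>]\<close>. It is needed
  because \<^const>\<open>expect\<close> is \<open>0\<close>, not \<open>\<infinity>\<close>, when the integrand is not integrable.\<close>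

definition nn_expect :: "'a measure \<Rightarrow> ('a \<Rightarrow> real) \<Rightarrow> ('a \<Rightarrow> real) \<Rightarrow> ennreal" where
  "nn_expect M p f = (\<integral>\<^sup>+x. ennreal (f x * p x) \<partial>M)"

definition covariance ::
  "'a measure \<Rightarrow> ('a \<Rightarrow> real) \<Rightarrow> ('a \<Rightarrow> real) \<Rightarrow> ('a \<Rightarrow> real) \<Rightarrow> real" where
  "covariance M p f g =
     expect M p (\<lambda>x. (f x - expect M p f) * (g x - expect M p g))"

text \<open>The space \<open>B\<^sub>p\<close> is represented by functions instead of almost-everywhere classes, so
  \<open>orlicz_norm\<close> is only a seminorm here. All notions below are invariant under
  almost-everywhere equality. For \<open>u\<close> in \<open>orlicz_space M p\<close> the mean
  exists as a genuine integral, since \<open>\<bar>t\<bar> \<le> 1 + (cosh t - 1)\<close>.\<close>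

definition orlicz_space :: "'a measure \<Rightarrow> ('a \<Rightarrow> real) \<Rightarrow> ('a \<Rightarrow> real) set" where
  "orlicz_space M p = {u \<in> borel_measurable M.
     (\<exists>\<alpha>>0. nn_expect M p (\<lambda>x. cosh (\<alpha> * u x) - 1) < \<infinity>) \<and> expect M p u = 0}"

definition orlicz_norm :: "'a measure \<Rightarrow> ('a \<Rightarrow> real) \<Rightarrow> ('a \<Rightarrow> real) \<Rightarrow> real" where
  "orlicz_norm M p u = Inf {r. r > 0 \<and> nn_expect M p (\<lambda>x. cosh (u x / r) - 1) \<le> 1}"

definition cumulant :: "'a measure \<Rightarrow> ('a \<Rightarrow> real) \<Rightarrow> ('a \<Rightarrow> real) \<Rightarrow> ereal" where
  "cumulant M p u =
     (let m = nn_expect M p (\<lambda>x. exp (u x))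
      in if m = \<infinity> then \<infinity> else ereal (ln (enn2real m)))"

definition cumulant_dom :: "'a measure \<Rightarrow> ('a \<Rightarrow> real) \<Rightarrow> ('a \<Rightarrow> real) set" where
  "cumulant_dom M p = {u \<in> orlicz_space M p. cumulant M p u < \<infinity>}"

definition orlicz_interior ::
  "'a measure \<Rightarrow> ('a \<Rightarrow> real) \<Rightarrow> ('a \<Rightarrow> real) set \<Rightarrow> ('a \<Rightarrow> real) set" where
  "orlicz_interior M p A = {u \<in> orlicz_space M p.
     \<exists>\<epsilon>>0. \<forall>v\<in>orlicz_space M p. orlicz_norm M p (\<lambda>x. v x - u x) < \<epsilon> \<longrightarrow> v \<in> A}"

text \<open>Linear independence in \<open>L\<^sup>2(p \<cdot> \<mu>)\<close>: the zero element of that space is the class of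
  functions vanishing \<open>p \<cdot> \<mu>\<close>-almost everywhere.\<close>

definition lin_indep_L2 ::
  "'a measure \<Rightarrow> ('a \<Rightarrow> real) \<Rightarrow> ('d::finite \<Rightarrow> 'a \<Rightarrow> real) \<Rightarrow> bool" where
  "lin_indep_L2 M p u \<longleftrightarrow>
     (\<forall>c. (AE x in density M (\<lambda>x. ennreal (p x)). (\<Sum>j\<in>UNIV. c j * u j x) = 0)
          \<longrightarrow> (\<forall>j. c j = 0))"

text \<open>The index type \<open>'d\<close> plays the role of \<open>{1, \<dots>, d}\<close>; being
  nonempty, it has \<open>d \<ge> 1\<close>.\<close>

definition lin_comb :: "('d::finite \<Rightarrow> 'a \<Rightarrow> real) \<Rightarrow> real^'d \<Rightarrow> 'a \<Rightarrow> real" where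
  "lin_comb u \<theta> x = (\<Sum>j\<in>UNIV. \<theta> $ j * u j x)"

definition param_space ::
  "'a measure \<Rightarrow> ('a \<Rightarrow> real) \<Rightarrow> ('d::finite \<Rightarrow> 'a \<Rightarrow> real) \<Rightarrow> (real^'d) set" where
  "param_space M p u = {\<theta>. lin_comb u \<theta> \<in> orlicz_interior M p (cumulant_dom M p)}"

definition psi ::
  "'a measure \<Rightarrow> ('a \<Rightarrow> real) \<Rightarrow> ('d::finite \<Rightarrow> 'a \<Rightarrow> real) \<Rightarrow> real^'d \<Rightarrow> real" where
  "psi M p u \<theta> = real_of_ereal (cumulant M p (lin_comb u \<theta>))"

definition exp_family ::
  "'a measure \<Rightarrow> ('a \<Rightarrow> real) \<Rightarrow> ('d::finite \<Rightarrow> 'a \<Rightarrow> real) \<Rightarrow> real^'d \<Rightarrow> 'a \<Rightarrow> real" where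
  "exp_family M p u \<theta> x = exp (lin_comb u \<theta> x - psi M p u \<theta>) * p x"

definition eta ::
  "'a measure \<Rightarrow> ('a \<Rightarrow> real) \<Rightarrow> ('d::finite \<Rightarrow> 'a \<Rightarrow> real) \<Rightarrow> real^'d \<Rightarrow> 'd \<Rightarrow> real" where
  "eta M p u \<theta> j = expect M (exp_family M p u \<theta>) (u j)"

definition third_central_moment ::
  "'a measure \<Rightarrow> ('a \<Rightarrow> real) \<Rightarrow> ('d::finite \<Rightarrow> 'a \<Rightarrow> real) \<Rightarrow> 'd \<Rightarrow> 'd \<Rightarrow> 'd \<Rightarrow> real^'d \<Rightarrow> real"
  where
  "third_central_moment M p u j l m \<theta> =
     expect M (exp_family M p u \<theta>)
       (\<lambda>x. (u j x - eta M p u \<theta> j) * (u l x - eta M p u \<theta> l) * (u m x - eta M p u \<theta> m))"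

definition fisher_info ::
  "'a measure \<Rightarrow> ('a \<Rightarrow> real) \<Rightarrow> ('d::finite \<Rightarrow> 'a \<Rightarrow> real) \<Rightarrow> real^'d \<Rightarrow> real^'d^'d" where
  "fisher_info M p u \<theta> = (\<chi> j k. covariance M (exp_family M p u \<theta>) (u j) (u k))"

text \<open>The \<open>d + 1\<close> coordinates are indexed by the type \<open>'d + 1\<close>: \<open>Inl j\<close> is the \<open>j\<close>-th
  coordinate, and the single value \<open>Inr _\<close> is the last one.\<close>

definition aug_vec :: "('d::finite \<Rightarrow> 'a \<Rightarrow> real) \<Rightarrow> 'a \<Rightarrow> real^('d + 1)" where
  "aug_vec u x = (\<chi> i. case i of Inl j \<Rightarrow> u j x | Inr _ \<Rightarrow> 1)"

definition moment_mat ::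
  "'a measure \<Rightarrow> ('a \<Rightarrow> real) \<Rightarrow> ('d::finite \<Rightarrow> 'a \<Rightarrow> real) \<Rightarrow> real^'d
    \<Rightarrow> real^('d + 1)^('d + 1)" where
  "moment_mat M p u \<theta> =
     expect_mat M (exp_family M p u \<theta>) (\<lambda>x. \<chi> i k. aug_vec u x $ i * aug_vec u x $ k)"

definition affine_inv_metric :: "real^'n^'n \<Rightarrow> real^'n^'n \<Rightarrow> real^'n^'n \<Rightarrow> real" where
  "affine_inv_metric S X Y = 1/2 * trace (matrix_inv S ** X ** matrix_inv S ** Y)"

definition partial_deriv ::
  "'d::finite \<Rightarrow> (real^'d \<Rightarrow> 'b::real_normed_vector) \<Rightarrow> real^'d \<Rightarrow> 'b" where
  "partial_deriv j F \<theta> = vector_derivative (\<lambda>t. F (\<theta> + t *\<^sub>R axis j 1)) (at 0)"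

text \<open>A line element at \<open>\<theta>\<close> is a quadratic form in the tangent vector \<open>d\<theta>\<close>, written \<open>v\<close>.\<close>

definition line_element_pullback ::
  "'a measure \<Rightarrow> ('a \<Rightarrow> real) \<Rightarrow> ('d::finite \<Rightarrow> 'a \<Rightarrow> real) \<Rightarrow> real^'d \<Rightarrow> real^'d \<Rightarrow> real" where
  "line_element_pullback M p u \<theta> v = (\<Sum>j\<in>UNIV. \<Sum>k\<in>UNIV.
     affine_inv_metric (moment_mat M p u \<theta>)
       (partial_deriv j (moment_mat M p u) \<theta>) (partial_deriv k (moment_mat M p u) \<theta>)
     * v $ j * v $ k)"

definition line_element_fisher ::
  "'a measure \<Rightarrow> ('a \<Rightarrow> real) \<Rightarrow> ('d::finite \<Rightarrow> 'a \<Rightarrow> real) \<Rightarrow> real^'d \<Rightarrow> real^'d \<Rightarrow> real" where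
  "line_element_fisher M p u \<theta> v =
     (\<Sum>j\<in>UNIV. \<Sum>k\<in>UNIV. fisher_info M p u \<theta> $ j $ k * v $ j * v $ k)"

end

theory Submission
  imports Defs "HOL-Probability.Probability_Measure"
begin

text \<open>
  Fix \<open>\<theta>\<close> in the parameter space, let \<open>N\<close> be the probability measure with density \<open>p\<^sub>\<theta>\<close>, and
  write \<open>w\<^sub>j = u\<^sub>j - \<eta>\<^sub>j\<close>. Two facts carry the proof.

  Analysis: since \<open>\<Sum>\<^sub>j \<theta>\<^sub>j u\<^sub>j\<close> is an interior point of the domain of \<open>K\<^sub>p\<close>, small perturbations of it in
  each direction \<open>\<plusminus>u\<^sub>j\<close> keep its exponential integrable, and therefore
  \<open>exp (\<delta> (\<bar>u\<^sub>1\<bar> + \<dots> + \<bar>u\<^sub>d\<bar>))\<close> is \<open>N\<close>-integrable for some \<open>\<delta> > 0\<close>. This makes all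
  polynomials in the \<open>u\<^sub>j\<close> integrable and allows differentiation under the integral. Moving \<open>\<theta>\<close> to
  \<open>\<theta> + t e\<^sub>j\<close> replaces \<open>E\<^sub>N[g]\<close> by \<open>E\<^sub>N[g exp (t u\<^sub>j)] / E\<^sub>N[exp (t u\<^sub>j)]\<close>, so the quotient rule gives
  \<open>\<partial>\<^sub>j S = E\<^sub>N[w\<^sub>j V V\<^sup>T]\<close>.

  Algebra: \<open>V = T W\<close> with \<open>W = (w\<^sub>1, \<dots>, w\<^sub>d, 1)\<close> and \<open>T\<close> the shear that adds the means. The metric
  is invariant under congruence by \<open>T\<close>, so \<open>V\<close> may be replaced by \<open>W\<close>. Then \<open>S\<close> becomes
  \<open>D = diag(I, 1)\<close>, and \<open>\<partial>\<^sub>j S\<close> becomes the matrix \<open>A\<^sub>j\<close> whose upper left block is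
  \<open>(\<kappa>\<^bsub>jlm\<^esub>)\<^bsub>l,m\<^esub>\<close>, whose border is the \<open>j\<close>-th row of \<open>I\<close>, and whose corner is \<open>E\<^sub>N[w\<^sub>j] = 0\<close>. If
  \<open>\<kappa> = 0\<close>, only the border survives; it is the same matrix as for a Gaussian family with fixed
  covariance, whose mean moves. Explicitly, \<open>D\<^sup>-\<^sup>1 A\<^sub>j\<close> has border column \<open>e\<^sub>j\<close> and border row \<open>I\<^sub>j\<close>, hence
  \<open>tr (D\<^sup>-\<^sup>1 A\<^sub>j D\<^sup>-\<^sup>1 A\<^sub>k) = I\<^bsub>kj\<^esub> + I\<^bsub>jk\<^esub> = 2 I\<^bsub>jk\<^esub>\<close>.

  The pieces meet in \<open>exp_family_measure\<close>, \<open>has_real_derivative_tilted_expectation\<close> and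
  \<open>affine_inv_metric_gram_eq_covariance\<close>.
\<close>

section \<open>Congruence invariance of the metric\<close>

lemma matrix_inv_left: "invertible (A::real^'n^'n) \<Longrightarrow> matrix_inv A ** A = mat 1"
  unfolding invertible_def matrix_inv_def by (rule someI2_ex) auto

lemma matrix_inv_right: "invertible (A::real^'n^'n) \<Longrightarrow> A ** matrix_inv A = mat 1"
  unfolding invertible_def matrix_inv_def by (rule someI2_ex) auto

lemma matrix_inv_eqI:
  fixes A B :: "real^'n^'n"
  assumes "B ** A = mat 1"
  shows "matrix_inv A = B"
proof -
  have "invertible A"
    using assms invertible_left_inverse by blast
  then have "B ** (A ** matrix_inv A) = B"
    by (simp add: matrix_inv_right)
  then show ?thesis
    by (simp add: matrix_mul_assoc assms)
qed

text \<open>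
  The two factors \<open>T\<^sup>-\<^sup>1 T\<close> inside the product cancel, and the outer conjugation by \<open>T\<^sup>T\<close> does not
  change the trace.
\<close>

lemma affine_inv_metric_congruence:
  fixes S T X Y :: "real^'n^'n"
  assumes S: "invertible S" and T: "invertible T"
  shows "affine_inv_metric (T ** S ** transpose T) (T ** X ** transpose T) (T ** Y ** transpose T)
       = affine_inv_metric S X Y"
proof -
  let ?Ti = "matrix_inv T" and ?Si = "matrix_inv S"
  have Tl: "Z ** ?Ti ** T = Z" for Z :: "real^'n^'n"
    by (simp add: matrix_mul_assoc[symmetric] matrix_inv_left[OF T])
  have Tt: "transpose T ** transpose ?Ti = mat 1"
    by (metis T matrix_inv_left matrix_transpose_mul transpose_mat)
  have Tr: "Z ** transpose T ** transpose ?Ti = Z" for Z :: "real^'n^'n"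
    by (simp add: matrix_mul_assoc[symmetric] Tt)
  have Sl: "Z ** ?Si ** S = Z" for Z :: "real^'n^'n"
    by (simp add: matrix_mul_assoc[symmetric] matrix_inv_left[OF S])
  have Tt': "transpose ?Ti ** transpose T = mat 1"
    using Tt matrix_left_right_inverse by blast
  have inv: "matrix_inv (T ** S ** transpose T) = transpose ?Ti ** ?Si ** ?Ti"
    by (rule matrix_inv_eqI) (simp add: matrix_mul_assoc Tl Sl Tt')
  have "trace (transpose ?Ti ** ?Si ** ?Ti ** (T ** X ** transpose T)
          ** (transpose ?Ti ** ?Si ** ?Ti) ** (T ** Y ** transpose T))
      = trace (transpose ?Ti ** (?Si ** X ** ?Si ** Y ** transpose T))"
    by (simp add: matrix_mul_assoc Tl Tr)
  also have "\<dots> = trace (?Si ** X ** ?Si ** Y ** transpose T ** transpose ?Ti)"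
    by (rule trace_mul_sym)
  also have "\<dots> = trace (?Si ** X ** ?Si ** Y)"
    by (simp only: Tr)
  finally show ?thesis
    by (simp add: affine_inv_metric_def inv)
qed

section \<open>Bordered matrices\<close>

text \<open>
  The block matrix with rows \<open>(B, b)\<close> and \<open>(c, d)\<close>: the last coordinate of \<open>V\<close> plays a special role,
  and the centred moment matrices, their derivatives and the centring shear all have this form.
\<close>

definition bordered ::
  "real^'d^'d \<Rightarrow> real^'d \<Rightarrow> real^'d \<Rightarrow> real \<Rightarrow> real^('d::finite + 1)^('d + 1)" where
  "bordered B b c d = (\<chi> i k. case i of
       Inl j \<Rightarrow> (case k of Inl l \<Rightarrow> B $ j $ l | Inr _ \<Rightarrow> b $ j)
     | Inr _ \<Rightarrow> (case k of Inl l \<Rightarrow> c $ l | Inr _ \<Rightarrow> d))"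

lemma bordered_nth [simp]:
  "bordered B b c d $ Inl j $ Inl l = B $ j $ l"
  "bordered B b c d $ Inl j $ Inr z = b $ j"
  "bordered B b c d $ Inr z $ Inl l = c $ l"
  "bordered B b c d $ Inr z $ Inr z' = d"
  by (simp_all add: bordered_def)

lemma sum_border_index:
  fixes f :: "'d::finite + 1 \<Rightarrow> 'b::comm_monoid_add"
  shows "(\<Sum>i\<in>UNIV. f i) = (\<Sum>j\<in>UNIV. f (Inl j)) + f (Inr 1)"
proof -
  have "(\<Sum>i\<in>UNIV. f i) = (\<Sum>i\<in>UNIV <+> UNIV. f i)"
    by (simp only: UNIV_Plus_UNIV)
  also have "\<dots> = (\<Sum>j\<in>UNIV. f (Inl j)) + (\<Sum>z\<in>UNIV. f (Inr z))"
    by (simp add: sum.Plus)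
  also have "(\<Sum>z\<in>UNIV. f (Inr z)) = f (Inr 1)"
    by (simp add: UNIV_1)
  finally show ?thesis .
qed

lemma border_eqI:
  assumes "\<And>j l. A $ Inl j $ Inl l = B $ Inl j $ Inl l" "\<And>j. A $ Inl j $ Inr 1 = B $ Inl j $ Inr 1"
    "\<And>l. A $ Inr 1 $ Inl l = B $ Inr 1 $ Inl l" "A $ Inr 1 $ Inr 1 = B $ Inr 1 $ Inr 1"
  shows "A = (B :: real^('d::finite + 1)^('d + 1))"
proof -
  have "A $ i $ k = B $ i $ k" for i k
    using assms by (cases i; cases k) (metis num1_eq1)+
  then show ?thesis by (simp add: vec_eq_iff)
qed

lemma bordered_mult:
  "bordered B b c d ** bordered B' b' c' d' =
     bordered (B ** B' + (\<chi> j l. b $ j * c' $ l)) (B *v b' + d' *\<^sub>R b)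
              (c v* B' + d *\<^sub>R c') (c \<bullet> b' + d * d')"
  by (rule border_eqI)
     (simp_all add: matrix_matrix_mult_def matrix_vector_mult_def vector_matrix_mult_def
       sum_border_index inner_vec_def mult.commute)

lemma trace_bordered: "trace (bordered B b c d) = trace B + d"
  by (simp add: trace_def sum_border_index)

lemma mat_1_bordered: "(mat 1 :: real^('d::finite + 1)^('d + 1)) = bordered (mat 1) 0 0 1"
  by (rule border_eqI) (simp_all add: mat_def)

text \<open>
  These matrices form a group: their borders \<open>b\<close> add up, so \<open>- b\<close> gives the inverse.
\<close>

lemma invertible_shear: "invertible (bordered (mat 1) b 0 1)"
proof -
  have *: "bordered (mat 1) b 0 1 ** bordered (mat 1) (- b) 0 1 = mat 1" for b :: "real^'d"
    by (simp add: bordered_mult mat_1_bordered matrix_vector_mul_lid zero_vec_def[symmetric])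
  from *[of b] *[of "- b"] show ?thesis
    unfolding invertible_def by auto
qed

text \<open>
  Tangent vectors with nothing but a border are the directions in which only the mean of a
  distribution with covariance \<open>F\<close> moves. The inverse of \<open>F\<close> never has to be computed: the matrix
  \<open>Q j\<close> below visibly solves \<open>D ** Q j = A j\<close>, and so equals \<open>D\<^sup>-\<^sup>1 ** A j\<close>.
\<close>

lemma affine_inv_metric_mean_directions:
  fixes F :: "real^'d::finite^'d"
  assumes sym: "transpose F = F" and inv: "invertible (bordered F 0 0 1)"
  shows "affine_inv_metric (bordered F 0 0 1) (bordered 0 (F $ j) (F $ j) 0)
           (bordered 0 (F $ k) (F $ k) 0) = F $ j $ k"
proof -
  define D where "D = bordered F 0 0 1"
  define Q where "Q j = bordered 0 (axis j 1) (F $ j) 0" for j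
  have F: "F $ a $ b = F $ b $ a" for a b
    by (metis sym transpose_def vec_lambda_beta)
  have "F *v axis j 1 = F $ j" for j
    by (simp add: vec_eq_iff matrix_vector_mult_basis column_def F)
  then have DQ: "D ** Q j = bordered 0 (F $ j) (F $ j) 0" for j
    by (simp add: D_def Q_def bordered_mult zero_vec_def[symmetric])
  then have "matrix_inv D ** bordered 0 (F $ j) (F $ j) 0 = Q j" for j
    by (metis D_def inv matrix_inv_left matrix_mul_assoc matrix_mul_lid)
  then have "affine_inv_metric D (bordered 0 (F $ j) (F $ j) 0) (bordered 0 (F $ k) (F $ k) 0)
      = 1/2 * trace (Q j ** Q k)"
    by (simp add: affine_inv_metric_def matrix_mul_assoc[symmetric])
  also have "\<dots> = 1/2 * (F $ k $ j + F $ j $ k)"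
    by (simp add: Q_def bordered_mult trace_bordered inner_axis)
       (simp add: trace_def axis_def if_distrib[of "\<lambda>x. x * _"] cong: if_cong)
  finally show ?thesis
    by (simp add: D_def F[of k j])
qed

section \<open>Exponential moments and differentiation under the integral\<close>

lemma exp_second_order_bound:
  fixes x :: real
  shows "\<bar>exp x - 1 - x\<bar> \<le> x\<^sup>2 * exp \<bar>x\<bar>"
proof -
  \<comment> \<open>This is \<open>1 - y \<le> exp (- y)\<close> multiplied by \<open>exp y\<close>; it bounds the remainder by \<open>x (exp x - 1)\<close>.\<close>
  have key: "exp y - 1 \<le> y * exp y" for y :: real
  proof -
    have "(1 - y) * exp y \<le> exp (- y) * exp y"
      using exp_ge_add_one_self[of "- y"] by (intro mult_right_mono) auto
    then show ?thesis by (simp add: exp_minus algebra_simps)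
  qed
  have "0 \<le> exp x - 1 - x"
    using exp_ge_add_one_self[of x] by linarith
  moreover have "exp x - 1 - x \<le> x * (exp x - 1)"
    using key[of x] by (simp add: algebra_simps)
  moreover have "x * (exp x - 1) \<le> x\<^sup>2 * exp \<bar>x\<bar>"
  proof (cases "x \<ge> 0")
    case True
    then show ?thesis
      using mult_left_mono[OF key[of x], of x] by (simp add: power2_eq_square algebra_simps)
  next
    case False
    have "(- x) * (1 - exp x) \<le> (- x) * (- x)"
    proof (rule mult_left_mono)
      show "1 - exp x \<le> - x" using exp_ge_add_one_self[of x] by linarith
    qed (use False in auto)
    moreover have "x\<^sup>2 * 1 \<le> x\<^sup>2 * exp \<bar>x\<bar>"
      by (intro mult_left_mono) auto
    ultimately show ?thesis
      by (simp add: power2_eq_square algebra_simps)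
  qed
  ultimately show ?thesis by linarith
qed

text \<open>
  The integrand has a Taylor remainder of at most \<open>t\<^sup>2\<close> times the fixed integrable function
  in the last hypothesis.
  Integrating this bound gives an error of order \<open>t\<^sup>2\<close>, so no limit theorem is involved.
\<close>

lemma has_real_derivative_integral_exp:
  fixes g h :: "'a \<Rightarrow> real"
  assumes [measurable]: "g \<in> borel_measurable N" "h \<in> borel_measurable N"
    and \<delta>: "0 < \<delta>" and g: "integrable N g" and gh: "integrable N (\<lambda>x. g x * h x)"
    and dom: "integrable N (\<lambda>x. \<bar>g x\<bar> * (h x)\<^sup>2 * exp (\<delta> * \<bar>h x\<bar>))"
  shows "((\<lambda>t. \<integral>x. g x * exp (t * h x) \<partial>N) has_real_derivative (\<integral>x. g x * h x \<partial>N)) (at 0)"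
proof -
  define C where "C = (\<integral>x. \<bar>g x\<bar> * (h x)\<^sup>2 * exp (\<delta> * \<bar>h x\<bar>) \<partial>N)"
  define rest where "rest t x = g x * (exp (t * h x) - 1 - t * h x)" for t x
  have [measurable]: "rest t \<in> borel_measurable N" for t
    unfolding rest_def by measurable
  have bound: "\<bar>rest t x\<bar> \<le> t\<^sup>2 * (\<bar>g x\<bar> * (h x)\<^sup>2 * exp (\<delta> * \<bar>h x\<bar>))" if "\<bar>t\<bar> \<le> \<delta>" for t x
  proof -
    have "\<bar>exp (t * h x) - 1 - t * h x\<bar> \<le> (t * h x)\<^sup>2 * exp \<bar>t * h x\<bar>"
      by (rule exp_second_order_bound)
    also have "\<dots> \<le> (t * h x)\<^sup>2 * exp (\<delta> * \<bar>h x\<bar>)"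
      using that by (intro mult_left_mono) (auto simp: abs_mult intro!: mult_right_mono)
    finally have "\<bar>g x\<bar> * \<bar>exp (t * h x) - 1 - t * h x\<bar> \<le> \<bar>g x\<bar> * ((t * h x)\<^sup>2 * exp (\<delta> * \<bar>h x\<bar>))"
      by (intro mult_left_mono) auto
    then show ?thesis
      by (simp add: rest_def abs_mult power_mult_distrib mult_ac)
  qed
  have int_rest: "integrable N (rest t)" if "\<bar>t\<bar> \<le> \<delta>" for t
    by (rule Bochner_Integration.integrable_bound[OF integrable_mult_right[OF dom, of "t\<^sup>2"]])
       (use bound[OF that] in \<open>auto intro!: AE_I2 order_trans[OF _ abs_ge_self]\<close>)
  have split: "g x * exp (t * h x) = g x + t * (g x * h x) + rest t x" for t x
    by (simp add: rest_def algebra_simps)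
  have err: "\<bar>(\<integral>x. g x * exp (t * h x) \<partial>N) - (\<integral>x. g x \<partial>N) - t * (\<integral>x. g x * h x \<partial>N)\<bar> \<le> t\<^sup>2 * C"
    if t: "\<bar>t\<bar> \<le> \<delta>" for t
  proof -
    have "(\<integral>x. g x * exp (t * h x) \<partial>N)
        = (\<integral>x. g x \<partial>N) + t * (\<integral>x. g x * h x \<partial>N) + (\<integral>x. rest t x \<partial>N)"
      unfolding split using g gh int_rest[OF t] by simp
    moreover have "\<bar>\<integral>x. rest t x \<partial>N\<bar> \<le> t\<^sup>2 * C"
    proof -
      have "\<bar>\<integral>x. rest t x \<partial>N\<bar> \<le> (\<integral>x. \<bar>rest t x\<bar> \<partial>N)"
        by (rule integral_abs_bound)
      also have "\<dots> \<le> (\<integral>x. t\<^sup>2 * (\<bar>g x\<bar> * (h x)\<^sup>2 * exp (\<delta> * \<bar>h x\<bar>)) \<partial>N)"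
        using int_rest[OF t] dom bound[OF t] by (intro integral_mono) auto
      finally show ?thesis by (simp add: C_def)
    qed
    ultimately show ?thesis by simp
  qed
  show "((\<lambda>t. \<integral>x. g x * exp (t * h x) \<partial>N) has_real_derivative (\<integral>x. g x * h x \<partial>N)) (at 0)"
    unfolding has_field_derivative_def has_derivative_at_alt
  proof (intro conjI allI impI)
    fix e :: real assume e: "0 < e"
    have C: "0 \<le> C" unfolding C_def by (intro integral_nonneg_AE) auto
    show "\<exists>d>0. \<forall>y. norm (y - 0) < d \<longrightarrow>
        norm ((\<integral>x. g x * exp (y * h x) \<partial>N) - (\<integral>x. g x * exp (0 * h x) \<partial>N)
          - (\<integral>x. g x * h x \<partial>N) * (y - 0)) \<le> e * norm (y - 0)"
    proof (intro exI[of _ "min \<delta> (e / (C + 1))"] conjI allI impI)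
      fix y :: real assume "norm (y - 0) < min \<delta> (e / (C + 1))"
      then have y: "\<bar>y\<bar> \<le> \<delta>" "\<bar>y\<bar> * (C + 1) \<le> e"
        using C by (auto simp: pos_less_divide_eq)
      have "y\<^sup>2 * C = \<bar>y\<bar> * (\<bar>y\<bar> * C)"
        by (simp add: power2_eq_square abs_mult_self_eq flip: mult.assoc)
      also have "\<dots> \<le> \<bar>y\<bar> * e"
        using y(2) by (intro mult_left_mono) (auto simp: algebra_simps)
      finally show "norm ((\<integral>x. g x * exp (y * h x) \<partial>N) - (\<integral>x. g x * exp (0 * h x) \<partial>N)
          - (\<integral>x. g x * h x \<partial>N) * (y - 0)) \<le> e * norm (y - 0)"
        using err[OF y(1)] by (simp add: mult.commute)
    qed (use \<delta> e C in auto)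
  qed (rule bounded_linear_mult_right)
qed

text \<open>
  A power of \<open>1 + W\<close> is absorbed by the spare exponential rate \<open>\<delta> - c\<close>.
\<close>

lemma integrable_of_exponential_moment:
  fixes W f :: "'a \<Rightarrow> real"
  assumes exp_moment: "integrable N (\<lambda>x. exp (\<delta> * W x))" and [measurable]: "f \<in> borel_measurable N"
    and W: "\<And>x. 0 \<le> W x" and c: "c < \<delta>"
    and f: "\<And>x. \<bar>f x\<bar> \<le> (1 + W x) ^ n * exp (c * W x)"
  shows "integrable N f"
proof -
  \<comment> \<open>The \<open>n\<close> factors \<open>1 + W\<close> share the spare rate; dividing by \<open>n + 1\<close> avoids the case \<open>n = 0\<close>.\<close>
  define \<epsilon> where "\<epsilon> = (\<delta> - c) / (real n + 1)"
  have \<epsilon>: "0 < \<epsilon>" "real n * \<epsilon> \<le> \<delta> - c"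
    using c by (auto simp: \<epsilon>_def field_simps)
  have "\<bar>f x\<bar> \<le> (1 / \<epsilon>) ^ n * exp (\<delta> - c) * exp (\<delta> * W x)" for x
  proof -
    have "\<epsilon> * (1 + W x) \<le> exp (\<epsilon> * (1 + W x))"
      using exp_ge_add_one_self[of "\<epsilon> * (1 + W x)"] by linarith
    then have "1 + W x \<le> 1 / \<epsilon> * exp (\<epsilon> * (1 + W x))"
      using \<epsilon> by (simp add: field_simps)
    then have "(1 + W x) ^ n \<le> (1 / \<epsilon> * exp (\<epsilon> * (1 + W x))) ^ n"
      using W[of x] by (intro power_mono) auto
    also have "\<dots> = (1 / \<epsilon>) ^ n * exp (real n * \<epsilon> * (1 + W x))"
      by (simp add: power_mult_distrib power_divide exp_of_nat_mult[symmetric] mult.assoc)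
    also have "\<dots> \<le> (1 / \<epsilon>) ^ n * exp ((\<delta> - c) * (1 + W x))"
      using \<epsilon> W[of x] by (intro mult_left_mono) (auto intro!: mult_right_mono)
    finally have "(1 + W x) ^ n * exp (c * W x)
        \<le> (1 / \<epsilon>) ^ n * exp ((\<delta> - c) * (1 + W x)) * exp (c * W x)"
      by (intro mult_right_mono) auto
    also have "\<dots> = (1 / \<epsilon>) ^ n * exp (\<delta> - c) * exp (\<delta> * W x)"
      by (simp add: mult.assoc exp_add[symmetric] algebra_simps)
    finally show ?thesis using f[of x] by linarith
  qed
  then show ?thesis
    by (intro Bochner_Integration.integrable_bound
        [OF integrable_mult_right[OF exp_moment, of "(1 / \<epsilon>) ^ n * exp (\<delta> - c)"]])
       (auto intro!: AE_I2 order_trans[OF _ abs_ge_self])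
qed

text \<open>
  The score of the exponential tilt in direction \<open>h\<close> is the centred statistic \<open>h - E[h]\<close>: this is the
  quotient rule for numerator and normalising constant, both differentiated under the integral.
\<close>

lemma (in prob_space) has_real_derivative_tilted_expectation:
  fixes W g h :: "'a \<Rightarrow> real"
  assumes exp_moment: "integrable M (\<lambda>x. exp (\<delta> * W x))" and \<delta>: "0 < \<delta>"
    and [measurable]: "g \<in> borel_measurable M" "h \<in> borel_measurable M"
    and h: "\<And>x. \<bar>h x\<bar> \<le> W x" and g: "\<And>x. \<bar>g x\<bar> \<le> (1 + W x) ^ n"
  shows "((\<lambda>t. (\<integral>x. g x * exp (t * h x) \<partial>M) / (\<integral>x. exp (t * h x) \<partial>M)) has_real_derivative
           (\<integral>x. (h x - (\<integral>y. h y \<partial>M)) * g x \<partial>M)) (at 0)"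
proof -
  have W: "0 \<le> W x" for x using h[of x] by linarith
  note integrableI = integrable_of_exponential_moment[OF exp_moment _ W]
  have dom: "\<bar>f x\<bar> * \<bar>h x\<bar> ^ k * exp (\<delta>/2 * \<bar>h x\<bar>) \<le> (1 + W x) ^ (m + k) * exp (\<delta>/2 * W x)"
    if "\<And>x. \<bar>f x\<bar> \<le> (1 + W x) ^ m" for f x k m
    unfolding power_add using h[of x] that[of x] W[of x] \<delta>
    by (intro mult_mono power_mono) auto
  have deriv: "integrable M f"
    "integrable M (\<lambda>x. f x * h x)"
    "((\<lambda>t. \<integral>x. f x * exp (t * h x) \<partial>M) has_real_derivative (\<integral>x. f x * h x \<partial>M)) (at 0)"
    if [measurable]: "f \<in> borel_measurable M" and f: "\<And>x. \<bar>f x\<bar> \<le> (1 + W x) ^ m" for f m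
  proof -
    show 1: "integrable M f"
      by (rule integrableI[of f 0 m]) (use f \<delta> in auto)
    show 2: "integrable M (\<lambda>x. f x * h x)"
    proof (rule integrableI[of _ 0 "m + 1"])
      show "\<bar>f x * h x\<bar> \<le> (1 + W x) ^ (m + 1) * exp (0 * W x)" for x
        unfolding abs_mult power_add using f[of x] h[of x] W[of x] by (auto intro!: mult_mono)
    qed (use \<delta> in auto)
    \<comment> \<open>Half of the rate \<open>\<delta>\<close> is kept to absorb the polynomial factors.\<close>
    have 3: "integrable M (\<lambda>x. \<bar>f x\<bar> * (h x)\<^sup>2 * exp (\<delta>/2 * \<bar>h x\<bar>))"
      by (rule integrableI[of _ "\<delta>/2" "m + 2"]) (use dom[OF f, of _ 2] \<delta> in \<open>auto simp: abs_mult\<close>)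
    show "((\<lambda>t. \<integral>x. f x * exp (t * h x) \<partial>M) has_real_derivative (\<integral>x. f x * h x \<partial>M)) (at 0)"
      by (rule has_real_derivative_integral_exp[OF _ _ _ 1 2 3]) (use \<delta> in auto)
  qed
  note dg = deriv[OF _ g] and d1 = deriv[of "\<lambda>_. 1" 0]
  have "((\<lambda>t. (\<integral>x. g x * exp (t * h x) \<partial>M) / (\<integral>x. 1 * exp (t * h x) \<partial>M)) has_real_derivative
           (\<integral>x. g x * h x \<partial>M) - (\<integral>x. g x \<partial>M) * (\<integral>x. h x \<partial>M)) (at 0)"
    using DERIV_divide[OF dg(3) d1(3)] by (simp add: prob_space)
  moreover have "(\<integral>x. (h x - (\<integral>y. h y \<partial>M)) * g x \<partial>M)
      = (\<integral>x. g x * h x \<partial>M) - (\<integral>x. g x \<partial>M) * (\<integral>x. h x \<partial>M)"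
    using dg(1,2) by (simp add: algebra_simps)
  ultimately show ?thesis by simp
qed

section \<open>Weighted second-moment matrices\<close>

text \<open>
  Both \<open>S(\<theta>) = E[V V\<^sup>T]\<close>, with weight \<open>g = 1\<close>, and its partial derivatives, with the centred statistics as
  weights, are of this kind.
\<close>

definition gram :: "'a measure \<Rightarrow> ('a \<Rightarrow> real) \<Rightarrow> ('a \<Rightarrow> real^'n) \<Rightarrow> real^'n^'n" where
  "gram N g X = (\<chi> i k. \<integral>x. g x * (X x $ i * X x $ k) \<partial>N)"

lemma gram_linear_image:
  fixes X :: "'a \<Rightarrow> real^'n" and T :: "real^'n^'n"
  assumes int: "\<And>i k. integrable N (\<lambda>x. g x * (X x $ i * X x $ k))"
  shows "gram N g (\<lambda>x. T *v X x) = T ** gram N g X ** transpose T"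
proof -
  have "gram N g (\<lambda>x. T *v X x) $ i $ k
      = (\<Sum>b\<in>UNIV. (\<Sum>a\<in>UNIV. T $ i $ a * gram N g X $ a $ b) * T $ k $ b)" for i k
  proof -
    have "g x * ((T *v X x) $ i * (T *v X x) $ k)
        = (\<Sum>b\<in>UNIV. \<Sum>a\<in>UNIV. T $ i $ a * T $ k $ b * (g x * (X x $ a * X x $ b)))" for x
      by (simp add: matrix_vector_mult_def sum_product sum_distrib_left mult_ac)
    then have "gram N g (\<lambda>x. T *v X x) $ i $ k
        = (\<Sum>b\<in>UNIV. \<Sum>a\<in>UNIV. T $ i $ a * T $ k $ b * gram N g X $ a $ b)"
      using int by (simp add: gram_def)
    then show ?thesis
      by (simp add: sum_distrib_left sum_distrib_right mult_ac)
  qed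
  then show ?thesis
    by (simp add: vec_eq_iff matrix_matrix_mult_def transpose_def)
qed

text \<open>
  The quadratic form of the matrix at \<open>c\<close> is \<open>E[(c \<bullet> X)\<^sup>2]\<close>, so a vector in its kernel is a linear
  relation that holds almost everywhere.
\<close>

lemma invertible_gram:
  fixes X :: "'a \<Rightarrow> real^'n"
  assumes int: "\<And>i k. integrable N (\<lambda>x. X x $ i * X x $ k)"
    and indep: "\<And>c. AE x in N. c \<bullet> X x = 0 \<Longrightarrow> c = 0"
  shows "invertible (gram N (\<lambda>_. 1) X)"
proof -
  have "c = 0" if c: "gram N (\<lambda>_. 1) X *v c = 0" for c
  proof -
    have sq: "(c \<bullet> X x)\<^sup>2 = (\<Sum>i\<in>UNIV. \<Sum>k\<in>UNIV. c $ i * c $ k * (X x $ i * X x $ k))" for x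
      by (simp add: inner_vec_def power2_eq_square sum_product mult_ac)
    have "(\<integral>x. (c \<bullet> X x)\<^sup>2 \<partial>N) = c \<bullet> (gram N (\<lambda>_. 1) X *v c)"
      unfolding sq using int
      by (simp add: gram_def inner_vec_def matrix_vector_mult_def sum_distrib_left mult_ac)
    moreover have "integrable N (\<lambda>x. (c \<bullet> X x)\<^sup>2)"
      unfolding sq using int by auto
    ultimately have "AE x in N. (c \<bullet> X x)\<^sup>2 = 0"
      using integral_nonneg_eq_0_iff_AE[of N "\<lambda>x. (c \<bullet> X x)\<^sup>2"] c by auto
    then show ?thesis by (intro indep) simp
  qed
  then show ?thesis
    by (simp add: invertible_left_inverse matrix_left_invertible_ker)
qed

lemma aug_vec_nth [simp]: "aug_vec u x $ Inl j = u j x" "aug_vec u x $ Inr z = 1"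
  by (simp_all add: aug_vec_def)

lemma aug_vec_shear:
  "aug_vec u x = bordered (mat 1) \<eta> 0 1 *v aug_vec (\<lambda>j x. u j x - \<eta> $ j) x"
proof -
  have "aug_vec u x $ i
      = (bordered (mat 1) \<eta> 0 1 *v aug_vec (\<lambda>j x. u j x - \<eta> $ j) x) $ i" for i
    by (cases i)
       (simp_all add: matrix_vector_mult_def sum_border_index mat_def
         if_distrib[of "\<lambda>x. x * _"] cong: if_cong)
  then show ?thesis by (simp add: vec_eq_iff)
qed

text \<open>
  The algebraic core. After congruence by the centring shear, the third moments are the inner blocks
  of the two tangent vectors, and their vanishing leaves mean directions only. Independence is
  required modulo constants because a relation among the centred statistics is an affine relation
  among the \<open>u j\<close>.
\<close>

lemma (in prob_space) affine_inv_metric_gram_eq_covariance: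
  fixes u :: "'d::finite \<Rightarrow> 'a \<Rightarrow> real"
  assumes int1: "\<And>j. integrable M (u j)"
    and int2: "\<And>j k. integrable M (\<lambda>x. u j x * u k x)"
    and int3: "\<And>j k l. integrable M (\<lambda>x. u j x * u k x * u l x)"
    and indep: "\<And>c b. AE x in M. (\<Sum>j\<in>UNIV. c j * u j x) = b \<Longrightarrow> \<forall>j. c j = 0"
  defines "w \<equiv> \<lambda>j x. u j x - (\<integral>y. u j y \<partial>M)"
  assumes skewless: "\<And>j k l. (\<integral>x. w j x * w k x * w l x \<partial>M) = 0"
  shows "affine_inv_metric (gram M (\<lambda>_. 1) (aug_vec u)) (gram M (w j) (aug_vec u))
           (gram M (w k) (aug_vec u)) = (\<integral>x. w j x * w k x \<partial>M)"
proof -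
  define \<eta> :: "real^'d" where "\<eta> = (\<chi> j. \<integral>y. u j y \<partial>M)"
  define T where "T = bordered (mat 1) \<eta> 0 1"
  define F where "F = (\<chi> j k. \<integral>x. w j x * w k x \<partial>M)"
  have i1: "integrable M (w j)" for j
    unfolding w_def using int1 by simp
  have i2: "integrable M (\<lambda>x. w j x * w k x)" for j k
    unfolding w_def using int1[of j] int1[of k] int2[of j k] by (simp add: algebra_simps)
  have i3: "integrable M (\<lambda>x. w j x * (w k x * w l x))" for j k l
  proof -
    let ?e = "\<lambda>j. \<integral>y. u j y \<partial>M"
    have "w j x * (w k x * w l x) = u j x * u k x * u l x
        - ?e l * (u j x * u k x) - ?e k * (u j x * u l x) - ?e j * (u k x * u l x)
        + ?e j * ?e k * u l x + ?e j * ?e l * u k x + ?e k * ?e l * u j x - ?e j * ?e k * ?e l" for x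
      by (simp add: w_def algebra_simps)
    then show ?thesis using int1 int2 int3[of j k l] by simp
  qed
  have mean: "(\<integral>x. w j x \<partial>M) = 0" for j
    unfolding w_def using int1 by (simp add: prob_space)
  have int_aug: "integrable M (\<lambda>x. aug_vec w x $ a * aug_vec w x $ b)" for a b
    by (cases a; cases b) (simp_all add: i1 i2)
  have int_aug': "integrable M (\<lambda>x. w j x * (aug_vec w x $ a * aug_vec w x $ b))" for j a b
    by (cases a; cases b) (simp_all add: i1 i2 i3)
  have aug: "aug_vec u = (\<lambda>x. T *v aug_vec w x)"
    using aug_vec_shear[of u _ \<eta>] by (simp add: fun_eq_iff T_def w_def \<eta>_def)
  have gram1: "gram M (\<lambda>_. 1) (aug_vec w) = bordered F 0 0 1"
    by (rule border_eqI) (simp_all add: gram_def F_def mean prob_space)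
  have gramw: "gram M (w j) (aug_vec w) = bordered 0 (F $ j) (F $ j) 0" for j
    \<comment> \<open>Third moments fill the inner block, covariances the border, and the mean the corner.\<close>
    using skewless by (intro border_eqI) (simp_all add: gram_def F_def mean mult.assoc)
  have inv: "invertible (bordered F 0 0 1)"
    unfolding gram1[symmetric]
  proof (rule invertible_gram[OF int_aug])
    fix c :: "real^('d + 1)" assume "AE x in M. c \<bullet> aug_vec w x = 0"
    then have "AE x in M. (\<Sum>j\<in>UNIV. c $ Inl j * u j x) = (\<Sum>j\<in>UNIV. c $ Inl j * \<eta> $ j) - c $ Inr 1"
      by (rule AE_mp) (simp add: inner_vec_def sum_border_index w_def \<eta>_def algebra_simps sum_subtractf)
    then have c: "c $ Inl j = 0" for j
      using indep[of "\<lambda>j. c $ Inl j"] by blast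
    moreover have "AE x in M. c $ Inr 1 = 0"
      using \<open>AE x in M. c \<bullet> aug_vec w x = 0\<close> by (simp add: inner_vec_def sum_border_index c)
    ultimately show "c = 0"
      by (simp add: vec_eq_iff AE_const) (metis num1_eq1 sum.exhaust)
  qed
  have "affine_inv_metric (gram M (\<lambda>_. 1) (aug_vec u)) (gram M (w j) (aug_vec u)) (gram M (w k) (aug_vec u))
      = affine_inv_metric (bordered F 0 0 1) (bordered 0 (F $ j) (F $ j) 0) (bordered 0 (F $ k) (F $ k) 0)"
    using int_aug int_aug' inv
    by (simp add: aug gram_linear_image gram1 gramw affine_inv_metric_congruence T_def invertible_shear)
  also have "\<dots> = F $ j $ k"
  proof (rule affine_inv_metric_mean_directions[OF _ inv])
    show "transpose F = F" by (simp add: F_def transpose_def mult.commute)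
  qed
  finally show ?thesis by (simp add: F_def)
qed

lemma has_vector_derivative_vecI:
  fixes f :: "real \<Rightarrow> 'b::real_normed_vector^'n"
  assumes "\<And>i. ((\<lambda>t. f t $ i) has_vector_derivative f' $ i) (at x)"
  shows "(f has_vector_derivative f') (at x)"
  using assms unfolding has_vector_derivative_def has_derivative_def
  by (auto intro!: vec_tendstoI bounded_linear_scaleR_left)

section \<open>The Orlicz space as exponential integrability\<close>

text \<open>
  Integrals against \<open>p \<cdot> \<mu>\<close> are treated as integrals with respect to the probability measure
  \<open>density M p\<close>. Integrability of \<open>p\<close> itself follows from its integral being nonzero.
\<close>

lemma densitiesD:
  assumes "p \<in> densities M"
  shows "p \<in> borel_measurable M" "AE x in M. 0 \<le> p x" "prob_space (density M p)"
proof -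
  show 1: "p \<in> borel_measurable M" and 2: "AE x in M. 0 \<le> p x"
    using assms by (auto simp: densities_def elim: eventually_mono)
  have "integrable M p"
    using assms not_integrable_integral_eq[of M p] by (auto simp: densities_def)
  then have "emeasure (density M p) (space (density M p)) = 1"
    using assms 1 2 by (simp add: emeasure_density nn_integral_eq_integral densities_def
        cong: nn_integral_cong)
  then show "prob_space (density M p)" by (rule prob_spaceI)
qed

lemma expect_eq_integral_density:
  assumes "p \<in> borel_measurable M" "AE x in M. 0 \<le> p x" "f \<in> borel_measurable M"
  shows "expect M p f = (\<integral>x. f x \<partial>density M p)"
  using assms by (simp add: expect_def integral_density mult.commute)

lemma nn_expect_eq_nn_integral_density:
  assumes [measurable]: "p \<in> borel_measurable M" "f \<in> borel_measurable M" and "AE x in M. 0 \<le> p x"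
  shows "nn_expect M p f = (\<integral>\<^sup>+x. f x \<partial>density M p)"
proof -
  have "(\<integral>\<^sup>+x. ennreal (f x * p x) \<partial>M) = (\<integral>\<^sup>+x. ennreal (p x) * ennreal (f x) \<partial>M)"
    using assms(3) by (intro nn_integral_cong_AE) (auto simp: ennreal_mult'' mult.commute)
  then show ?thesis
    by (simp add: nn_expect_def nn_integral_density)
qed

lemma nn_expect_finite_iff:
  assumes "p \<in> borel_measurable M" "AE x in M. 0 \<le> p x" "f \<in> borel_measurable M" "\<And>x. 0 \<le> f x"
  shows "nn_expect M p f < \<infinity> \<longleftrightarrow> integrable (density M p) f"
  using assms by (simp add: nn_expect_eq_nn_integral_density integrable_iff_bounded)

lemma cosh_mono_abs:
  fixes x y :: real
  assumes "\<bar>x\<bar> \<le> \<bar>y\<bar>"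
  shows "cosh x \<le> cosh y"
  using assms cosh_real_nonneg_le_iff[of "\<bar>x\<bar>" "\<bar>y\<bar>"] by simp

lemma borel_measurable_cosh [measurable]:
  fixes f :: "'a \<Rightarrow> real"
  assumes [measurable]: "f \<in> borel_measurable P"
  shows "(\<lambda>x. cosh (f x)) \<in> borel_measurable P"
  unfolding cosh_field_def by measurable

lemma integrable_cosh_mono:
  assumes "integrable P (\<lambda>x. cosh (b * u x))" "\<bar>a\<bar> \<le> \<bar>b\<bar>" and [measurable]: "u \<in> borel_measurable P"
  shows "integrable P (\<lambda>x. cosh (a * u x :: real))"
  by (rule Bochner_Integration.integrable_bound[OF assms(1)])
     (use assms(2) in \<open>auto intro!: cosh_mono_abs simp: abs_mult mult_right_mono\<close>)

lemma orlicz_space_iff: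
  assumes p: "p \<in> densities M"
  shows "u \<in> orlicz_space M p \<longleftrightarrow> u \<in> borel_measurable M
    \<and> (\<exists>\<alpha>>0. integrable (density M p) (\<lambda>x. cosh (\<alpha> * u x))) \<and> (\<integral>x. u x \<partial>density M p) = 0"
proof -
  note D = densitiesD[OF p]
  interpret prob_space "density M p" by (rule D(3))
  have "nn_expect M p (\<lambda>x. cosh (\<alpha> * u x) - 1) < \<infinity> \<longleftrightarrow> integrable (density M p) (\<lambda>x. cosh (\<alpha> * u x))"
    if [measurable]: "u \<in> borel_measurable M" for \<alpha>
  proof -
    have "nn_expect M p (\<lambda>x. cosh (\<alpha> * u x) - 1) < \<infinity>
        \<longleftrightarrow> integrable (density M p) (\<lambda>x. cosh (\<alpha> * u x) - 1)"
      by (intro nn_expect_finite_iff D) (auto simp: cosh_real_ge_1)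
    also have "\<dots> \<longleftrightarrow> integrable (density M p) (\<lambda>x. cosh (\<alpha> * u x))"
      using Bochner_Integration.integrable_add[of "density M p" "\<lambda>x. cosh (\<alpha> * u x) - 1" "\<lambda>_. 1"]
      by auto
    finally show ?thesis .
  qed
  then show ?thesis
    by (auto simp: orlicz_space_def expect_eq_integral_density[OF D(1,2)])
qed

lemma orlicz_space_integrable:
  assumes p: "p \<in> densities M" and u: "u \<in> orlicz_space M p"
  shows "integrable (density M p) u"
proof -
  obtain \<alpha> where \<alpha>: "\<alpha> > 0" "integrable (density M p) (\<lambda>x. cosh (\<alpha> * u x))"
    and [measurable]: "u \<in> borel_measurable M"
    using u orlicz_space_iff[OF p] by auto
  have "\<bar>u x\<bar> \<le> 2 / \<alpha> * cosh (\<alpha> * u x)" for x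
  proof -
    have "\<bar>\<alpha> * u x\<bar> \<le> exp \<bar>\<alpha> * u x\<bar>"
      using exp_ge_add_one_self[of "\<bar>\<alpha> * u x\<bar>"] by linarith
    also have "\<dots> \<le> 2 * cosh \<bar>\<alpha> * u x\<bar>"
      by (simp only: cosh_field_def) simp
    also have "\<dots> = 2 * cosh (\<alpha> * u x)"
      by (simp only: cosh_real_abs)
    finally have "\<alpha> * \<bar>u x\<bar> \<le> 2 * cosh (\<alpha> * u x)"
      using \<alpha>(1) by (simp only: abs_mult abs_of_pos)
    then show ?thesis using \<alpha> by (simp add: field_simps)
  qed
  then show ?thesis
    by (intro Bochner_Integration.integrable_bound[OF integrable_mult_right[OF \<alpha>(2), of "2 / \<alpha>"]])
       (use \<alpha>(1) in \<open>auto intro!: AE_I2 simp: abs_of_pos\<close>)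
qed

text \<open>
  For a sum, the larger of the two terms dominates: \<open>cosh (a + b) \<le> cosh (2 a) + cosh (2 b)\<close>.
\<close>

lemma orlicz_space_add_scaled:
  assumes p: "p \<in> densities M" and f: "f \<in> orlicz_space M p" and v: "v \<in> orlicz_space M p"
  shows "(\<lambda>x. f x + s * v x) \<in> orlicz_space M p"
proof -
  obtain a where a: "a > 0" "integrable (density M p) (\<lambda>x. cosh (a * f x))"
    and [measurable]: "f \<in> borel_measurable M"
    using f orlicz_space_iff[OF p] by auto
  obtain b where b: "b > 0" "integrable (density M p) (\<lambda>x. cosh (b * v x))"
    and [measurable]: "v \<in> borel_measurable M"
    using v orlicz_space_iff[OF p] by auto
  \<comment> \<open>The rate is so small that the doubled arguments stay within the rates of \<open>f\<close> and \<open>v\<close>; the \<open>+ 1\<close> allows \<open>s = 0\<close>.\<close>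
  define c where "c = min (a / 2) (b / (2 * (\<bar>s\<bar> + 1)))"
  have c: "0 < c" "\<bar>2 * c\<bar> \<le> \<bar>a\<bar>"
    using a(1) b(1) min.cobounded1[of "a / 2" "b / (2 * (\<bar>s\<bar> + 1))"]
    by (auto simp: c_def)
  have "c \<le> b / (2 * (\<bar>s\<bar> + 1))"
    by (simp only: c_def min.cobounded2)
  then have "2 * c * (\<bar>s\<bar> + 1) \<le> b"
    by (simp add: pos_le_divide_eq algebra_simps)
  then have cs: "\<bar>2 * c * s\<bar> \<le> \<bar>b\<bar>"
    using c b(1) by (simp add: abs_mult algebra_simps)
  have bound: "cosh (c * (f x + s * v x)) \<le> cosh (2 * c * f x) + cosh (2 * c * s * v x)" for x
  proof (cases "\<bar>f x\<bar> \<le> \<bar>s * v x\<bar>")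
    case True
    then have "\<bar>f x + s * v x\<bar> \<le> \<bar>2 * (s * v x)\<bar>" by linarith
    then have "cosh (c * (f x + s * v x)) \<le> cosh (c * (2 * (s * v x)))"
      using c(1) by (intro cosh_mono_abs) (simp only: abs_mult[of c] mult_left_mono abs_ge_zero)
    then show ?thesis by (simp add: mult_ac add_increasing)
  next
    case False
    then have "\<bar>f x + s * v x\<bar> \<le> \<bar>2 * f x\<bar>" by linarith
    then have "cosh (c * (f x + s * v x)) \<le> cosh (c * (2 * f x))"
      using c(1) by (intro cosh_mono_abs) (simp only: abs_mult[of c] mult_left_mono abs_ge_zero)
    then show ?thesis by (simp add: mult_ac add_increasing2)
  qed
  have "integrable (density M p) (\<lambda>x. cosh (2 * c * f x) + cosh (2 * c * s * v x))"
    using integrable_cosh_mono[OF a(2) c(2)] integrable_cosh_mono[OF b(2) cs] by simp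
  then have "integrable (density M p) (\<lambda>x. cosh (c * (f x + s * v x)))"
    by (rule Bochner_Integration.integrable_bound)
       (auto intro!: AE_I2 order_trans[OF bound] abs_ge_self)
  moreover have "(\<integral>x. f x + s * v x \<partial>density M p) = 0"
    using orlicz_space_integrable[OF p f] orlicz_space_integrable[OF p v] f v
    by (simp add: orlicz_space_iff[OF p])
  ultimately show ?thesis
    using c(1) by (auto simp: orlicz_space_iff[OF p])
qed

lemma cosh_scaled_le:
  fixes x :: real
  assumes "0 \<le> t" "t \<le> 1"
  shows "cosh (t * x) - 1 \<le> t * (cosh x - 1)"
proof -
  have e: "exp (t * y) \<le> (1 - t) + t * exp y" for y :: real
    using convex_onD[OF exp_convex assms, of 0 y] by simp
  show ?thesis
    using e[of x] e[of "- x"] by (simp add: cosh_field_def field_simps)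
qed

text \<open>
  Multiples of a fixed element tend to zero in norm. The constant \<open>r\<close> is essentially a bound on the
  norm of \<open>v\<close>: by convexity, shrinking the argument of \<open>cosh - 1\<close> by the factor \<open>1 + C\<close> shrinks its mean
  \<open>C\<close> to at most 1. The form with \<open>\<epsilon> > 0\<close> covers \<open>s = 0\<close>, where the infimum is not attained.
\<close>

lemma orlicz_norm_scaled_le:
  assumes p: "p \<in> densities M" and v: "v \<in> orlicz_space M p"
  obtains r where "0 < r" "\<And>s \<epsilon>. 0 < \<epsilon> \<Longrightarrow> \<bar>s\<bar> * r \<le> \<epsilon> \<Longrightarrow> orlicz_norm M p (\<lambda>x. s * v x) \<le> \<epsilon>"
proof -
  note D = densitiesD[OF p]
  interpret prob_space "density M p" by (rule D(3))
  obtain \<alpha> where \<alpha>: "\<alpha> > 0" "integrable (density M p) (\<lambda>x. cosh (\<alpha> * v x))"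
    and [measurable]: "v \<in> borel_measurable M"
    using v orlicz_space_iff[OF p] by auto
  define C where "C = (\<integral>x. cosh (\<alpha> * v x) - 1 \<partial>density M p)"
  have C: "0 \<le> C" unfolding C_def by (intro integral_nonneg_AE) (auto simp: cosh_real_ge_1)
  define r where "r = (1 + C) / \<alpha>"
  have r: "0 < r" using C \<alpha> by (simp add: r_def)
  have "orlicz_norm M p (\<lambda>x. s * v x) \<le> \<epsilon>" if \<epsilon>: "0 < \<epsilon>" "\<bar>s\<bar> * r \<le> \<epsilon>" for s \<epsilon>
  proof -
    have le: "cosh (s * v x / \<epsilon>) - 1 \<le> 1 / (1 + C) * (cosh (\<alpha> * v x) - 1)" for x
    proof -
      have "\<bar>s * v x / \<epsilon>\<bar> = \<bar>s\<bar> / \<epsilon> * \<bar>v x\<bar>" using \<epsilon> by (simp add: abs_mult)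
      also have "\<dots> \<le> 1 / r * \<bar>v x\<bar>"
        using \<epsilon> r by (intro mult_right_mono) (auto simp: field_simps)
      also have "\<dots> = \<bar>1 / (1 + C) * (\<alpha> * v x)\<bar>"
        using \<alpha> C by (simp add: r_def abs_mult)
      finally have "cosh (s * v x / \<epsilon>) \<le> cosh (1 / (1 + C) * (\<alpha> * v x))"
        by (rule cosh_mono_abs)
      then show ?thesis
        using cosh_scaled_le[of "1 / (1 + C)" "\<alpha> * v x"] C by simp
    qed
    have "nn_expect M p (\<lambda>x. cosh (s * v x / \<epsilon>) - 1)
        = (\<integral>\<^sup>+x. ennreal (cosh (s * v x / \<epsilon>) - 1) \<partial>density M p)"
      by (intro nn_expect_eq_nn_integral_density D) auto
    also have "\<dots> \<le> (\<integral>\<^sup>+x. ennreal (1 / (1 + C) * (cosh (\<alpha> * v x) - 1)) \<partial>density M p)"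
      by (intro nn_integral_mono ennreal_leI le)
    also have "\<dots> = ennreal (\<integral>x. 1 / (1 + C) * (cosh (\<alpha> * v x) - 1) \<partial>density M p)"
      using \<alpha>(2) C by (intro nn_integral_eq_integral) (auto simp: cosh_real_ge_1)
    also have "\<dots> = ennreal (C / (1 + C))"
      by (simp add: C_def)
    also have "\<dots> \<le> 1"
      using C by simp
    finally show ?thesis
      unfolding orlicz_norm_def using \<epsilon> by (intro cInf_lower bdd_belowI[of _ 0]) auto
  qed
  with r that show ?thesis by blast
qed

section \<open>Exponential moments at interior parameters\<close>

lemma orlicz_interior_exp_moment:
  assumes p: "p \<in> densities M" and f: "f \<in> orlicz_interior M p (cumulant_dom M p)"
    and v: "v \<in> orlicz_space M p"
  shows "\<exists>\<delta>>0. \<forall>s. \<bar>s\<bar> \<le> \<delta> \<longrightarrow> integrable (density M p) (\<lambda>x. exp (f x + s * v x))"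
proof -
  obtain \<epsilon> where \<epsilon>: "0 < \<epsilon>" and f': "f \<in> orlicz_space M p"
    and nbhd: "\<And>w. w \<in> orlicz_space M p \<Longrightarrow> orlicz_norm M p (\<lambda>x. w x - f x) < \<epsilon>
      \<Longrightarrow> w \<in> cumulant_dom M p"
    using f by (auto simp: orlicz_interior_def)
  obtain r where r: "0 < r"
    and norm: "\<And>s \<epsilon>. 0 < \<epsilon> \<Longrightarrow> \<bar>s\<bar> * r \<le> \<epsilon> \<Longrightarrow> orlicz_norm M p (\<lambda>x. s * v x) \<le> \<epsilon>"
    using orlicz_norm_scaled_le[OF p v] by metis
  have "integrable (density M p) (\<lambda>x. exp (f x + s * v x))" if s: "\<bar>s\<bar> \<le> \<epsilon> / 2 / r" for s
  proof -
    have "orlicz_norm M p (\<lambda>x. s * v x) \<le> \<epsilon> / 2"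
      using \<epsilon> r s by (intro norm) (auto simp: field_simps)
    then have "(\<lambda>x. f x + s * v x) \<in> cumulant_dom M p"
      using \<epsilon> by (intro nbhd orlicz_space_add_scaled p f' v) simp
    then have "nn_expect M p (\<lambda>x. exp (f x + s * v x)) < \<infinity>"
      by (auto simp: cumulant_dom_def cumulant_def Let_def less_top split: if_splits)
    moreover have "(\<lambda>x. f x + s * v x) \<in> borel_measurable M"
      using f' v by (auto simp: orlicz_space_def)
    ultimately show ?thesis
      using densitiesD[OF p] by (subst nn_expect_finite_iff[symmetric]) auto
  qed
  then show ?thesis using \<epsilon> r by (intro exI[of _ "\<epsilon> / 2 / r"]) auto
qed

text \<open>
  The sum \<open>\<Sum>\<^sub>j \<bar>u\<^sub>j\<bar>\<close> is at most \<open>d\<close> times its largest term, so its exponential is controlled by the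
  finitely many perturbations in the coordinate directions \<open>\<plusminus>u\<^sub>j\<close>, each of which is admissible by
  the previous lemma.
\<close>

lemma param_space_exp_moment:
  fixes u :: "'d::finite \<Rightarrow> 'a \<Rightarrow> real"
  assumes p: "p \<in> densities M" and u: "\<And>j. u j \<in> orlicz_space M p"
    and \<theta>: "\<theta> \<in> param_space M p u"
  obtains \<delta> where "0 < \<delta>"
    "integrable (density M p) (\<lambda>x. exp (lin_comb u \<theta> x + \<delta> * (\<Sum>j\<in>UNIV. \<bar>u j x\<bar>)))"
proof -
  have [measurable]: "u j \<in> borel_measurable M" for j
    using u by (auto simp: orlicz_space_def)
  have f: "lin_comb u \<theta> \<in> orlicz_interior M p (cumulant_dom M p)"
    using \<theta> by (simp add: param_space_def)
  have [measurable]: "lin_comb u \<theta> \<in> borel_measurable M"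
    unfolding lin_comb_def[abs_def] by measurable
  obtain \<delta> where \<delta>: "\<And>j. 0 < \<delta> j"
    "\<And>j s. \<bar>s\<bar> \<le> \<delta> j \<Longrightarrow> integrable (density M p) (\<lambda>x. exp (lin_comb u \<theta> x + s * u j x))"
    using orlicz_interior_exp_moment[OF p f u] by metis
  define m where "m = Min (range \<delta>)"
  have m: "0 < m" "\<And>j. m \<le> \<delta> j"
    using \<delta>(1) by (auto simp: m_def)
  define n where "n = real CARD('d)"
  have n: "0 < n" by (simp add: n_def)
  let ?e = "\<lambda>s j x. exp (lin_comb u \<theta> x + s * u j x)"
  have bound: "exp (lin_comb u \<theta> x + m / n * (\<Sum>j\<in>UNIV. \<bar>u j x\<bar>)) \<le> (\<Sum>j\<in>UNIV. ?e m j x + ?e (- m) j x)" for x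
  proof -
    obtain i where i: "\<And>j. \<bar>u j x\<bar> \<le> \<bar>u i x\<bar>"
      using Max_in[of "range (\<lambda>j. \<bar>u j x\<bar>)"] Max_ge[of "range (\<lambda>j. \<bar>u j x\<bar>)"] by fastforce
    have "(\<Sum>j\<in>UNIV. \<bar>u j x\<bar>) \<le> n * \<bar>u i x\<bar>"
      using sum_bounded_above[of UNIV "\<lambda>j. \<bar>u j x\<bar>" "\<bar>u i x\<bar>"] i by (simp add: n_def)
    then have "m / n * (\<Sum>j\<in>UNIV. \<bar>u j x\<bar>) \<le> m * \<bar>u i x\<bar>"
      using m(1) n mult_left_mono[of "(\<Sum>j\<in>UNIV. \<bar>u j x\<bar>)" "n * \<bar>u i x\<bar>" "m / n"] by simp
    then have "exp (lin_comb u \<theta> x + m / n * (\<Sum>j\<in>UNIV. \<bar>u j x\<bar>)) \<le> exp (lin_comb u \<theta> x + m * \<bar>u i x\<bar>)"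
      by simp
    also have "\<dots> \<le> ?e m i x + ?e (- m) i x"
      by (cases "u i x \<ge> 0") auto
    also have "\<dots> \<le> (\<Sum>j\<in>UNIV. ?e m j x + ?e (- m) j x)"
      by (rule member_le_sum) (auto intro: add_nonneg_nonneg)
    finally show ?thesis .
  qed
  have "integrable (density M p) (\<lambda>x. \<Sum>j\<in>UNIV. ?e m j x + ?e (- m) j x)"
    using m \<delta>(2)[of m] \<delta>(2)[of "- m"]
    by (intro Bochner_Integration.integrable_sum Bochner_Integration.integrable_add \<delta>(2)) auto
  then have "integrable (density M p) (\<lambda>x. exp (lin_comb u \<theta> x + m / n * (\<Sum>j\<in>UNIV. \<bar>u j x\<bar>)))"
  proof (rule Bochner_Integration.integrable_bound)
    show "AE x in density M p. norm (exp (lin_comb u \<theta> x + m / n * (\<Sum>j\<in>UNIV. \<bar>u j x\<bar>)))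
        \<le> norm (\<Sum>j\<in>UNIV. ?e m j x + ?e (- m) j x)"
      unfolding real_norm_def abs_exp_cancel by (intro AE_I2 order_trans[OF bound abs_ge_self])
  qed measurable
  with m n that[of "m / n"] show ?thesis by simp
qed

text \<open>
  When the normalising integral is finite, \<open>exp (- \<psi> \<theta>)\<close> is its reciprocal. Where the cumulant is
  infinite, \<open>psi\<close> has the value 0, and this fails.
\<close>

lemma expect_exp_family:
  fixes u :: "'d::finite \<Rightarrow> 'a \<Rightarrow> real"
  assumes p: "p \<in> densities M" and [measurable]: "\<And>j. u j \<in> borel_measurable M" "g \<in> borel_measurable M"
    and int: "integrable (density M p) (\<lambda>x. exp (lin_comb u \<theta> x))"
  shows "expect M (exp_family M p u \<theta>) g = (\<integral>x. g x * exp (lin_comb u \<theta> x) \<partial>density M p)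
           / (\<integral>x. exp (lin_comb u \<theta> x) \<partial>density M p)"
    and "0 < (\<integral>x. exp (lin_comb u \<theta> x) \<partial>density M p)"
proof -
  note D = densitiesD[OF p]
  interpret prob_space "density M p" by (rule D(3))
  define Z where "Z = (\<integral>x. exp (lin_comb u \<theta> x) \<partial>density M p)"
  have [measurable]: "lin_comb u \<theta> \<in> borel_measurable M"
    unfolding lin_comb_def[abs_def] by measurable
  have "Z \<noteq> 0"
    unfolding Z_def using integral_nonneg_eq_0_iff_AE[OF int] AE_False by auto
  moreover have "0 \<le> Z"
    unfolding Z_def by (intro integral_nonneg_AE) auto
  ultimately have Z: "0 < Z" by simp
  have "nn_expect M p (\<lambda>x. exp (lin_comb u \<theta> x)) = ennreal Z"
    using int by (simp add: nn_expect_eq_nn_integral_density D nn_integral_eq_integral Z_def)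
  then have "exp (- psi M p u \<theta>) = 1 / Z"
    using Z by (simp add: psi_def cumulant_def Let_def exp_minus inverse_eq_divide)
  then have "exp_family M p u \<theta> x = exp (lin_comb u \<theta> x) / Z * p x" for x
    unfolding exp_family_def diff_conv_add_uminus exp_add by simp
  then have "expect M (exp_family M p u \<theta>) g = expect M p (\<lambda>x. g x * exp (lin_comb u \<theta> x) / Z)"
    by (simp add: expect_def mult.assoc)
  also have "\<dots> = (\<integral>x. g x * exp (lin_comb u \<theta> x) / Z \<partial>density M p)"
    by (intro expect_eq_integral_density D) measurable
  finally show "expect M (exp_family M p u \<theta>) g = (\<integral>x. g x * exp (lin_comb u \<theta> x) \<partial>density M p)
           / (\<integral>x. exp (lin_comb u \<theta> x) \<partial>density M p)"
    by (simp add: Z_def)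
  show "0 < (\<integral>x. exp (lin_comb u \<theta> x) \<partial>density M p)"
    using Z by (simp add: Z_def)
qed

text \<open>
  Moving the parameter by \<open>t\<close> along an axis tilts the measure \<open>N\<close> with density \<open>p\<^sub>\<theta>\<close> by \<open>exp (t u\<^sub>j)\<close>. The null
  sets of \<open>N\<close> are those of \<open>p \<cdot> \<mu>\<close> since the exponential is positive; this transports linear
  independence from the reference measure to \<open>N\<close>.
\<close>

lemma exp_family_measure:
  fixes u :: "'d::finite \<Rightarrow> 'a \<Rightarrow> real"
  assumes p: "p \<in> densities M" and u: "\<And>j. u j \<in> orlicz_space M p"
    and \<theta>: "\<theta> \<in> param_space M p u"
  obtains N \<delta> where "prob_space N" "sets N = sets M" "0 < \<delta>"
    "integrable N (\<lambda>x. exp (\<delta> * (\<Sum>j\<in>UNIV. \<bar>u j x\<bar>)))"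
    "\<And>P. (AE x in N. P x) \<longleftrightarrow> (AE x in density M p. P x)"
    "\<And>g j t. g \<in> borel_measurable M \<Longrightarrow> \<bar>t\<bar> \<le> \<delta> \<Longrightarrow>
       expect M (exp_family M p u (\<theta> + t *\<^sub>R axis j 1)) g =
       (\<integral>x. g x * exp (t * u j x) \<partial>N) / (\<integral>x. exp (t * u j x) \<partial>N)"
proof -
  have [measurable]: "u j \<in> borel_measurable M" for j
    using u by (auto simp: orlicz_space_def)
  let ?f = "lin_comb u \<theta>" and ?W = "\<lambda>x. \<Sum>j\<in>UNIV. \<bar>u j x\<bar>"
  have [measurable]: "lin_comb u \<theta> \<in> borel_measurable M" for \<theta>
    unfolding lin_comb_def[abs_def] by measurable
  obtain \<delta> where \<delta>: "0 < \<delta>" and int: "integrable (density M p) (\<lambda>x. exp (?f x + \<delta> * ?W x))"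
    using param_space_exp_moment[OF p u \<theta>] by metis
  have W: "\<bar>u j x\<bar> \<le> ?W x" for j x
    by (rule member_le_sum) auto
  have shift: "lin_comb u (\<theta> + t *\<^sub>R axis j 1) x = ?f x + t * u j x" for t j x
    by (simp add: lin_comb_def axis_def algebra_simps sum.distrib if_distrib[of "\<lambda>x. x * _"]
        if_distrib[of "\<lambda>x. _ * x"] cong: if_cong)
  have int_shift: "integrable (density M p) (\<lambda>x. exp (lin_comb u (\<theta> + t *\<^sub>R axis j 1) x))"
    if "\<bar>t\<bar> \<le> \<delta>" for t j
  proof (rule Bochner_Integration.integrable_bound[OF int])
    have "t * u j x \<le> \<delta> * ?W x" for x
      using abs_ge_self[of "t * u j x"] mult_mono[OF that W[of j x]] \<delta>
      unfolding abs_mult by linarith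
    then show "AE x in density M p. norm (exp (lin_comb u (\<theta> + t *\<^sub>R axis j 1) x)) \<le> norm (exp (?f x + \<delta> * ?W x))"
      by (simp add: shift)
  qed measurable
  have int0: "integrable (density M p) (\<lambda>x. exp (?f x))"
    using int_shift[of 0] \<delta> by simp
  define Z where "Z = (\<integral>x. exp (?f x) \<partial>density M p)"
  have Z: "0 < Z"
    unfolding Z_def by (rule expect_exp_family(2)[OF p _ _ int0, of "\<lambda>_. 0"]) auto
  define N where "N = density (density M p) (\<lambda>x. ennreal (exp (?f x) / Z))"
  have N_integral: "(\<integral>x. g x \<partial>N) = (\<integral>x. exp (?f x) * g x \<partial>density M p) / Z"
    if [measurable]: "g \<in> borel_measurable M" for g
    unfolding N_def using Z by (subst integral_density) auto
  have N_integrable: "integrable N g"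
    if [measurable]: "g \<in> borel_measurable M" and "integrable (density M p) (\<lambda>x. exp (?f x) * g x)"
    for g :: "'a \<Rightarrow> real"
    unfolding N_def using Z that(2) by (subst integrable_density) auto
  show thesis
  proof
    show "prob_space N"
    proof
      have "emeasure N (space N) = (\<integral>\<^sup>+x. ennreal (exp (?f x) / Z) \<partial>density M p)"
        by (simp add: N_def emeasure_density) (rule nn_integral_cong, simp)
      also have "\<dots> = ennreal (\<integral>x. exp (?f x) / Z \<partial>density M p)"
        using int0 Z by (intro nn_integral_eq_integral) auto
      finally show "emeasure N (space N) = 1"
        using Z by (simp add: Z_def)
    qed
    show "sets N = sets M" by (simp add: N_def)
    show "0 < \<delta>" by (rule \<delta>)
    show "integrable N (\<lambda>x. exp (\<delta> * ?W x))"
      using int by (intro N_integrable) (simp_all add: exp_add)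
    show "(AE x in N. P x) \<longleftrightarrow> (AE x in density M p. P x)" for P
      unfolding N_def using Z by (subst AE_density) auto
    fix g :: "'a \<Rightarrow> real" and j and t :: real
    assume [measurable]: "g \<in> borel_measurable M" and t: "\<bar>t\<bar> \<le> \<delta>"
    show "expect M (exp_family M p u (\<theta> + t *\<^sub>R axis j 1)) g =
       (\<integral>x. g x * exp (t * u j x) \<partial>N) / (\<integral>x. exp (t * u j x) \<partial>N)"
      using Z by (subst expect_exp_family(1)[OF p _ _ int_shift[OF t]])
         (simp_all add: shift N_integral exp_add mult_ac)
  qed
qed

section \<open>Equality of the line elements\<close>

theorem lemma5p7:
  fixes M :: "'a measure" and p :: "'a \<Rightarrow> real" and u :: "'d::finite \<Rightarrow> 'a \<Rightarrow> real"
  assumes "sigma_finite_measure M"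
    and "p \<in> densities M"
    and "\<And>j. u j \<in> orlicz_space M p"
    and "lin_indep_L2 M p u"
    and "\<And>j l m \<theta>. \<theta> \<in> param_space M p u \<Longrightarrow> third_central_moment M p u j l m \<theta> = 0"
  shows "\<forall>\<theta> \<in> param_space M p u. \<forall>v.
           line_element_pullback M p u \<theta> v = line_element_fisher M p u \<theta> v"
proof (intro ballI allI)
  fix \<theta> v assume \<theta>: "\<theta> \<in> param_space M p u"
  note p = assms(2) and u = assms(3)
  have u_meas: "u j \<in> borel_measurable M" for j
    using u by (auto simp: orlicz_space_def)
  let ?W = "\<lambda>x. \<Sum>j\<in>UNIV. \<bar>u j x\<bar>" and ?V = "aug_vec u"
  obtain N \<delta> where N: "prob_space N" "sets N = sets M" and \<delta>: "0 < \<delta>"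
    and exp_moment: "integrable N (\<lambda>x. exp (\<delta> * ?W x))"
    and AE_N: "\<And>P. (AE x in N. P x) \<longleftrightarrow> (AE x in density M p. P x)"
    and tilt: "\<And>g j t. g \<in> borel_measurable M \<Longrightarrow> \<bar>t\<bar> \<le> \<delta> \<Longrightarrow>
       expect M (exp_family M p u (\<theta> + t *\<^sub>R axis j 1)) g =
       (\<integral>x. g x * exp (t * u j x) \<partial>N) / (\<integral>x. exp (t * u j x) \<partial>N)"
    by (rule exp_family_measure[OF p u \<theta>]) (rule that; assumption)
  interpret prob_space N by (rule N(1))
  have meas: "borel_measurable N = (borel_measurable M :: ('a \<Rightarrow> real) set)"
    by (rule measurable_cong_sets[OF N(2) refl])
  have [measurable]: "u j \<in> borel_measurable N" for j
    using u_meas meas by simp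
  have expect: "expect M (exp_family M p u \<theta>) g = (\<integral>x. g x \<partial>N)" if "g \<in> borel_measurable N" for g
    using tilt[of g 0] that meas \<delta> by (simp add: prob_space)
  have W: "\<bar>u j x\<bar> \<le> ?W x" "0 \<le> ?W x" for j x
    by (rule member_le_sum) (auto intro: sum_nonneg)
  have W1: "\<bar>u j x\<bar> \<le> 1 + ?W x" for j x using W(1)[of j x] by linarith
  have aug_meas [measurable]: "(\<lambda>x. ?V x $ a) \<in> borel_measurable N" for a
    by (cases a) simp_all
  have aug: "\<bar>?V x $ a\<bar> \<le> 1 + ?W x" for a x
    using W1 W(2) by (cases a) auto
  have aug2: "\<bar>?V x $ a * ?V x $ b\<bar> \<le> (1 + ?W x) ^ 2" for a b x
    unfolding abs_mult power2_eq_square using aug W(2)[of x] by (intro mult_mono) auto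
  have aug3: "\<bar>?V x $ a * ?V x $ b * ?V x $ c\<bar> \<le> (1 + ?W x) ^ 3" for a b c x
    using mult_mono[OF aug2[of x a b] aug[of x c]] W(2)[of x]
    by (simp add: abs_mult power3_eq_cube power2_eq_square)
  have int3: "integrable N (\<lambda>x. ?V x $ a * ?V x $ b * ?V x $ c)" for a b c
    by (rule integrable_of_exponential_moment[OF exp_moment, of _ 0 3]) (use aug3 \<delta> W(2) in auto)
  define w where "w = (\<lambda>j x. u j x - (\<integral>y. u j y \<partial>N))"
  have eta: "eta M p u \<theta> j = (\<integral>y. u j y \<partial>N)" for j
    by (simp add: eta_def expect)
  have skewless: "(\<integral>x. w j x * w k x * w l x \<partial>N) = 0" for j k l
    using assms(5)[OF \<theta>, of j k l]
    by (simp add: third_central_moment_def eta expect w_def)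
  have fisher: "fisher_info M p u \<theta> $ j $ k = (\<integral>x. w j x * w k x \<partial>N)" for j k
    by (simp add: fisher_info_def covariance_def expect w_def)
  \<comment> \<open>Elements of \<open>B\<^sub>p\<close> have mean zero under \<open>p\<close>, so a constant combination of them is zero.\<close>
  have indep: "\<forall>j. c j = 0" if c: "AE x in N. (\<Sum>j\<in>UNIV. c j * u j x) = b" for c b
  proof -
    interpret P: prob_space "density M p" by (rule densitiesD[OF p])
    have c': "AE x in density M p. (\<Sum>j\<in>UNIV. c j * u j x) = b"
      using c AE_N by simp
    have "b = (\<integral>x. b \<partial>density M p)"
      using P.prob_space by simp
    also have "\<dots> = (\<integral>x. (\<Sum>j\<in>UNIV. c j * u j x) \<partial>density M p)"
      using c' u_meas by (intro integral_cong_AE) auto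
    also have "\<dots> = 0"
      using orlicz_space_integrable[OF p u] u by (simp add: orlicz_space_iff[OF p])
    finally show ?thesis
      using c' assms(4) by (auto simp: lin_indep_L2_def)
  qed
  have S: "moment_mat M p u \<theta> = gram N (\<lambda>_. 1) ?V"
    by (simp add: moment_mat_def expect_mat_def gram_def expect vec_eq_iff)
  have dS: "partial_deriv j (moment_mat M p u) \<theta> = gram N (w j) ?V" for j
    unfolding partial_deriv_def
  proof (intro vector_derivative_at has_vector_derivative_vecI)
    fix a b
    let ?g = "\<lambda>x. ?V x $ a * ?V x $ b"
    have "((\<lambda>t. (\<integral>x. ?g x * exp (t * u j x) \<partial>N) / (\<integral>x. exp (t * u j x) \<partial>N))
        has_real_derivative (gram N (w j) ?V $ a $ b)) (at 0)"
      using has_real_derivative_tilted_expectation[OF exp_moment \<delta>, of ?g "u j" 2] W aug2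
      by (simp add: gram_def w_def)
    \<comment> \<open>The tilting formula is available for \<open>\<bar>t\<bar> \<le> \<delta>\<close>, and the derivative depends only on \<open>t\<close> near 0.\<close>
    moreover have "\<forall>\<^sub>F t in nhds 0. (\<integral>x. ?g x * exp (t * u j x) \<partial>N) / (\<integral>x. exp (t * u j x) \<partial>N)
        = moment_mat M p u (\<theta> + t *\<^sub>R axis j 1) $ a $ b"
      unfolding eventually_nhds_metric
    proof (intro exI[of _ \<delta>] conjI \<delta> allI impI)
      fix t :: real assume "dist t 0 < \<delta>"
      then show "(\<integral>x. ?g x * exp (t * u j x) \<partial>N) / (\<integral>x. exp (t * u j x) \<partial>N)
        = moment_mat M p u (\<theta> + t *\<^sub>R axis j 1) $ a $ b"
        by (simp add: moment_mat_def expect_mat_def tilt meas[symmetric])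
    qed
    ultimately have "((\<lambda>t. moment_mat M p u (\<theta> + t *\<^sub>R axis j 1) $ a $ b)
        has_real_derivative (gram N (w j) ?V $ a $ b)) (at 0)"
      by (rule DERIV_cong_ev[OF refl _ refl, THEN iffD1, rotated])
    then show "((\<lambda>t. moment_mat M p u (\<theta> + t *\<^sub>R axis j 1) $ a $ b)
        has_vector_derivative (gram N (w j) ?V $ a $ b)) (at 0)"
      by (simp add: has_real_derivative_iff_has_vector_derivative)
  qed
  have "affine_inv_metric (gram N (\<lambda>_. 1) ?V) (gram N (w j) ?V) (gram N (w k) ?V)
      = (\<integral>x. w j x * w k x \<partial>N)" for j k
    unfolding w_def
  proof (rule affine_inv_metric_gram_eq_covariance[OF _ _ _ indep])
    show "integrable N (u j)" for j using int3[of "Inl j" "Inr 1" "Inr 1"] by simp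
    show "integrable N (\<lambda>x. u j x * u k x)" for j k using int3[of "Inl j" "Inl k" "Inr 1"] by simp
    show "integrable N (\<lambda>x. u j x * u k x * u l x)" for j k l
      using int3[of "Inl j" "Inl k" "Inl l"] by simp
  qed (use skewless in \<open>auto simp: w_def\<close>)
  then show "line_element_pullback M p u \<theta> v = line_element_fisher M p u \<theta> v"
    by (simp add: line_element_pullback_def line_element_fisher_def S dS fisher)
qed

end
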